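(* Let $\varepsilon\in\mathbb{C}\setminus\{0\}$ (in particular, $\varepsilon=\pm1$), and consider the ordinary differential equation $$y''(x)=\frac{(y'(x))^2}{y(x)}-\frac{y'(x)}{x}-\frac1x\left(8\varepsilon (y(x))^2+\frac12\right)-\frac{1}{4y(x)}$$ and its formal solution $$y(x)=-\frac{x}{2}\left(1+\sum_{m=1}^{\infty}c_m x^m\right),$$ where $c_1\in\mathbb{C}$ is a parameter and, with $c_0=1$, the coefficients $c_m$, $m\geqslant2$, are determined by substituting the series into the equation, that is, by the recurrence relation $$(m^2-1)c_m=\sum_{p=0}^{m-2}(p+2)\bigl(m-2(p+1)\bigr)c_{p+1}c_{m-p-1}+4\varepsilon\sum_{p=0}^{m-2}\sum_{p_1=0}^{p}c_{m-p-2}\,c_{p_1}\,c_{p-p_1}.$$ Then, for all $c_1\in\mathbb{C}$, this series converges, that is, it represents the Taylor-series expansion at $x=0$ of a solution of the differential equation. (Via the substitutions $b=a=\kappa\,\mathrm{i}/2$, $\kappa=\pm1$, $\tau=x$, $u(\tau)=y(x)$, it also represents the Taylor-series expansion at $\tau=0$ of a solution of the degenerate third Painlevé equation $u''=\frac{(u')^2}{u}-\frac{u'}{\tau}+\frac1\tau\left(-8\varepsilon u^2+2ab\right)+\frac{b^2}{u}$.)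
   Context: The prime denotes differentiation with respect to the argument of the function ($x$ for $y$, $\tau$ for $u$). The differential equation for $y$ is the degenerate third Painlevé equation for $u$ in the normalization $a=b=\kappa\,\mathrm{i}/2$, $\kappa=\pm1$, $\tau=x$, $u(\tau)=y(x)$. "Converges" means convergence in a neighbourhood of $x=0$ (positive radius of convergence). *)

theory Defs
  imports "HOL-Complex_Analysis.Complex_Analysis"
begin

text \<open>
  A solution on an open set avoids the singular loci \<open>x = 0\<close> and \<open>y = 0\<close> of the equation, since
  \<open>z / 0 = 0\<close> would otherwise give the right-hand side a spurious meaning there. Holomorphy
  makes \<^const>\<open>deriv\<close> the true derivative.
\<close>

definition ode_solution_on :: "complex \<Rightarrow> (complex \<Rightarrow> complex) \<Rightarrow> complex set \<Rightarrow> bool" where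
  "ode_solution_on \<epsilon> y S \<longleftrightarrow> open S \<and> y holomorphic_on S \<and>
     (\<forall>x\<in>S. x \<noteq> 0 \<and> y x \<noteq> 0 \<and>
        deriv (deriv y) x =
          (deriv y x)\<^sup>2 / y x - deriv y x / x - (1 / x) * (8 * \<epsilon> * (y x)\<^sup>2 + 1 / 2) - 1 / (4 * y x))"

definition degenerate_PIII_solution_on ::
    "complex \<Rightarrow> complex \<Rightarrow> complex \<Rightarrow> (complex \<Rightarrow> complex) \<Rightarrow> complex set \<Rightarrow> bool" where
  "degenerate_PIII_solution_on \<epsilon> a b u S \<longleftrightarrow> open S \<and> u holomorphic_on S \<and>
     (\<forall>\<tau>\<in>S. \<tau> \<noteq> 0 \<and> u \<tau> \<noteq> 0 \<and>
        deriv (deriv u) \<tau> =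
          (deriv u \<tau>)\<^sup>2 / u \<tau> - deriv u \<tau> / \<tau> + (1 / \<tau>) * (- 8 * \<epsilon> * (u \<tau>)\<^sup>2 + 2 * a * b) + b\<^sup>2 / u \<tau>)"

text \<open>The same equation for \<open>y\<close>, read in the field of formal Laurent series.\<close>

definition ode_formal_solution :: "complex \<Rightarrow> complex fls \<Rightarrow> bool" where
  "ode_formal_solution \<epsilon> Y \<longleftrightarrow> Y \<noteq> 0 \<and>
     fls_deriv (fls_deriv Y) =
       (fls_deriv Y)\<^sup>2 / Y - fls_deriv Y / fls_X
         - (1 / fls_X) * (8 * fls_const \<epsilon> * Y\<^sup>2 + 1 / 2) - 1 / (4 * Y)"

text \<open>\<open>-x/2 \<cdot> (\<Sum>m. c\<^sub>m x\<^sup>m)\<close>; the leading \<open>1\<close> of the bracket is \<open>c\<^sub>0\<close>.\<close>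

definition y_series :: "(nat \<Rightarrow> complex) \<Rightarrow> complex fps" where
  "y_series c = fps_const (- 1 / 2) * fps_X * Abs_fps c"

text \<open>The factor \<open>m - 2(p+1)\<close> may be negative, hence is formed in the complex numbers; the
  subtractions in the indices never truncate.\<close>

definition coeff_recurrence :: "complex \<Rightarrow> (nat \<Rightarrow> complex) \<Rightarrow> bool" where
  "coeff_recurrence \<epsilon> c \<longleftrightarrow>
     (\<forall>m\<ge>2. ((of_nat m)\<^sup>2 - 1) * c m =
        (\<Sum>p=0..m-2. (of_nat p + 2) * (of_nat m - 2 * (of_nat p + 1)) * c (p + 1) * c (m - p - 1))
        + 4 * \<epsilon> * (\<Sum>p=0..m-2. \<Sum>q=0..p. c (m - p - 2) * c q * c (p - q)))"

end

theory Submission imports Defs begin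

unbundle no vec_syntax

text \<open>
  Writing \<open>y = -x g / 2\<close> with \<open>g(0) = 1\<close> and \<open>\<theta> = x d/dx\<close>, the equation for \<open>y\<close> is equivalent to
  \<open>g \<theta>\<^sup>2g - (\<theta>g)\<^sup>2 - 4\<epsilon>x\<^sup>2g\<^sup>3 - g + 1 = 0\<close>, whose coefficients are the recurrence up to a sum that
  vanishes by antisymmetry. For convergence, \<open>(p + 2) \<bar>m - 2(p + 1)\<bar> \<le> m (m - 2) \<le> m\<^sup>2 - 1\<close>, so the
  partial sums \<open>S\<^sub>n\<close> of \<open>\<Sum>\<^sub>m\<^sub>\<ge>\<^sub>1 \<bar>c\<^sub>m\<bar> t\<^sup>m\<close> satisfy
  \<open>S\<^sub>n\<^sub>+\<^sub>1 \<le> \<bar>c\<^sub>1\<bar>t + S\<^sub>n\<^sup>2 + 4\<bar>\<epsilon>\<bar>t\<^sup>2(1 + S\<^sub>n)\<^sup>3\<close>, and the bound \<open>S\<^sub>n \<le> 1/2\<close> is inherited from \<open>n\<close> to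
  \<open>n + 1\<close> for small \<open>t\<close>.
\<close>

section \<open>Existence and uniqueness of the coefficient sequence\<close>

definition recurrence_rhs :: "complex \<Rightarrow> (nat \<Rightarrow> complex) \<Rightarrow> nat \<Rightarrow> complex" where
  "recurrence_rhs \<epsilon> c m =
     (\<Sum>p=0..m-2. (of_nat p + 2) * (of_nat m - 2 * (of_nat p + 1)) * c (p + 1) * c (m - p - 1))
     + 4 * \<epsilon> * (\<Sum>p=0..m-2. \<Sum>q=0..p. c (m - p - 2) * c q * c (p - q))"

lemma coeff_recurrence_altdef:
  "coeff_recurrence \<epsilon> c \<longleftrightarrow> (\<forall>m\<ge>2. ((of_nat m)\<^sup>2 - 1) * c m = recurrence_rhs \<epsilon> c m)"
  by (simp add: coeff_recurrence_def recurrence_rhs_def)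

text \<open>For \<open>m\<close> at least 2 every index on the right is at most
  \<open>m - 1\<close>, so the recurrence is a well-founded recursion. Below 2 the truncated
  \<open>m - 2\<close> would leave the term \<open>p = 0\<close>, which reads
  \<open>c 1\<close>.\<close>

lemma recurrence_rhs_cong:
  assumes "m \<ge> 2" "\<And>k. k < m \<Longrightarrow> c k = d k"
  shows "recurrence_rhs \<epsilon> c m = recurrence_rhs \<epsilon> d m"
  unfolding recurrence_rhs_def using assms(1)
  by (intro arg_cong2[where f = "(+)"] arg_cong2[where f = "(*)"] sum.cong refl)
     (auto intro!: assms(2))

text \<open>The only natural zero of the factor is \<open>m = 1\<close>: this resonance leaves
  \<open>c 1\<close> free, while every later coefficient can be solved for.\<close>

lemma of_nat_power2_minus_1_neq_0:
  assumes "m \<ge> 2"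
  shows "(of_nat m)\<^sup>2 - 1 \<noteq> (0 :: complex)"
proof
  assume "(of_nat m)\<^sup>2 - 1 = (0 :: complex)"
  hence "of_nat (m\<^sup>2) = (of_nat 1 :: complex)" by simp
  hence "m\<^sup>2 = 1" by (simp only: of_nat_eq_iff)
  with assms show False by (simp add: power2_eq_square)
qed

lemma coeff_recurrence_unique:
  assumes "coeff_recurrence \<epsilon> c" "coeff_recurrence \<epsilon> d" "c 0 = d 0" "c 1 = d 1"
  shows "c = d"
proof
  fix m
  show "c m = d m"
  proof (induction m rule: less_induct)
    case (less m)
    show ?case
    proof (cases "m \<ge> 2")
      case True
      have "((of_nat m)\<^sup>2 - 1) * c m = ((of_nat m)\<^sup>2 - 1) * d m"
        using assms(1,2) recurrence_rhs_cong[OF True less, where \<epsilon> = \<epsilon>] True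
        unfolding coeff_recurrence_altdef by simp
      thus ?thesis using of_nat_power2_minus_1_neq_0[OF True] by simp
    next
      case False
      hence "m = 0 \<or> m = 1" by auto
      thus ?thesis using assms by auto
    qed
  qed
qed

lemma coeff_recurrence_exists:
  "\<exists>c. c 0 = 1 \<and> c 1 = c1 \<and> coeff_recurrence \<epsilon> c"
proof -
  define F where "F = (\<lambda>c m. if m = 0 then 1 else if m = 1 then c1
      else recurrence_rhs \<epsilon> c m / ((of_nat m)\<^sup>2 - 1))"
  define c where "c = wfrec less_than F"
  \<comment> \<open>Admissibility means that \<open>F c m\<close> reads \<open>c\<close> only below
    \<open>m\<close>; the fixpoint equation \<open>c = F c\<close> rests on it.\<close>
  have "adm_wf less_than F"
    unfolding adm_wf_def F_def by (auto intro!: recurrence_rhs_cong)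
  hence c: "c m = F c m" for m
    unfolding c_def by (intro wfrec_fixpoint[THEN fun_cong]) simp_all
  have "c 0 = 1" "c 1 = c1"
    by (simp_all add: c[of 0] c[of "Suc 0"] F_def)
  moreover have "coeff_recurrence \<epsilon> c"
    unfolding coeff_recurrence_altdef
  proof (intro allI impI)
    fix m :: nat assume m: "m \<ge> 2"
    hence "c m = recurrence_rhs \<epsilon> c m / ((of_nat m)\<^sup>2 - 1)"
      by (subst c) (simp add: F_def)
    thus "((of_nat m)\<^sup>2 - 1) * c m = recurrence_rhs \<epsilon> c m"
      using of_nat_power2_minus_1_neq_0[OF m] by simp
  qed
  ultimately show ?thesis by blast
qed

section \<open>Equivalence of the formal equation and the recurrence\<close>

definition y_residual :: "complex \<Rightarrow> complex fps \<Rightarrow> complex fps" where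
  "y_residual \<epsilon> Y = fps_X * (Y * fps_deriv (fps_deriv Y) - (fps_deriv Y)\<^sup>2) + Y * fps_deriv Y
     + fps_const (8 * \<epsilon>) * Y ^ 3 + fps_const (1 / 2) * Y + fps_const (1 / 4) * fps_X"

definition g_residual :: "complex \<Rightarrow> complex fps \<Rightarrow> complex fps" where
  "g_residual \<epsilon> G = (let \<theta> = (\<lambda>F. fps_X * fps_deriv F) in
     \<theta> (\<theta> G) * G - (\<theta> G)\<^sup>2 - fps_const (4 * \<epsilon>) * (fps_X\<^sup>2 * (G * G * G)) - G + 1)"

text \<open>With \<theta> = x d/dx, the differential part x(YY'' - Y'^2) + YY' is formally Y^2
  \<theta>^2(log Y)/x. Since \<theta>^2 annihilates log x, the prefactor -x/2 of G contributes only
  the factor x/4.\<close>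

lemma y_residual_eq_g_residual:
  "y_residual \<epsilon> (fps_const (- 1 / 2) * fps_X * G) = fps_const (1 / 4) * fps_X * g_residual \<epsilon> G"
proof -
  \<comment> \<open>Replacing 1/2 by an opaque \<open>h\<close> with \<open>h * 2 = 1\<close> and
    derivative 0 reduces the claim to a ring identity.\<close>
  define h where "h = fps_const (1 / 2 :: complex)"
  have h2: "fps_const (1 / 4) = h * h" "fps_const (-1 / 2) = -h"
      "fps_const (8 * \<epsilon>) = 8 * fps_const \<epsilon>" "fps_const (4 * \<epsilon>) = 4 * fps_const \<epsilon>"
      "fps_const (1 / 2) = h" "h * 2 = 1"
    by (simp_all add: h_def fps_numeral_fps_const flip: fps_const_1_eq_1)
  have h_deriv: "fps_deriv h = 0" by (simp add: h_def)
  show ?thesis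
    unfolding y_residual_def g_residual_def Let_def h2
    using h2(6) by (simp add: h_deriv, algebra)
qed

lemma fps_X_power2_mult_nth: "(fps_X\<^sup>2 * F) $ m = (if m < 2 then 0 else F $ (m - 2))"
  by (simp add: fps_X_power_mult_nth)

lemma g_residual_nth:
  assumes "c 0 = 1" "m \<ge> 2"
  shows "g_residual \<epsilon> (Abs_fps c) $ m = ((of_nat m)\<^sup>2 - 1) * c m - recurrence_rhs \<epsilon> c m"
proof -
  define \<theta> :: "complex fps \<Rightarrow> complex fps" where "\<theta> = (\<lambda>F. fps_X * fps_deriv F)"
  define G where "G = Abs_fps c"
  obtain n where n: "m = Suc (Suc n)" using assms(2) by (metis add_2_eq_Suc le_Suc_ex)
  have \<theta>: "\<theta> F $ k = of_nat k * F $ k" for F k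
    unfolding \<theta>_def by (cases k) simp_all
  \<comment> \<open>The weights i^2 from \<open>\<theta> (\<theta> G) * G\<close> and i(m - i) from
    the square of \<open>\<theta> G\<close> combine to i(2i - m).\<close>
  let ?f = "\<lambda>i. of_nat i * (2 * of_nat i - of_nat m) * c i * c (m - i)"
  have "(\<theta> (\<theta> G) * G - (\<theta> G)\<^sup>2) $ m = (\<Sum>i=0..m. ?f i)"
    unfolding power2_eq_square fps_sub_nth fps_mult_nth sum_subtractf[symmetric] \<theta> G_def
    by (intro sum.cong) (auto simp: of_nat_diff algebra_simps)
  \<comment> \<open>The term i = 0 vanishes, and i = m gives m^2 c_m because c_0 = 1.\<close>
  also have "\<dots> = (\<Sum>i=0..n. ?f (Suc i)) + (of_nat m)\<^sup>2 * c m"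
    unfolding n by (subst sum.atLeast0_atMost_Suc, subst sum.atLeast0_atMost_Suc_shift)
      (simp add: assms power2_eq_square algebra_simps)
  also have "(\<Sum>i=0..n. ?f (Suc i)) =
     -(\<Sum>p=0..n. (of_nat p + 2) * (of_nat m - 2 * (of_nat p + 1)) * c (p + 1) * c (m - p - 1))"
    (is "_ = - ?S")
  proof -
    \<comment> \<open>Up to sign, the recurrence has weight p + 2 where the coefficient has p + 1.
      The difference is the sum of \<open>a\<close>, which is odd under the reflection p -> n -
      p.\<close>
    define a where "a = (\<lambda>p. (of_nat m - 2 * (of_nat p + 1)) * c (p + 1) * c (m - p - 1))"
    have "(\<Sum>p=0..n. a p) = (\<Sum>p=0..n. a (n - p))"
      using sum.atLeastAtMost_rev[of a 0 n] by simp
    also have "\<dots> = (\<Sum>p=0..n. - a p)"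
      by (intro sum.cong) (auto simp: a_def n of_nat_diff Suc_diff_le algebra_simps)
    finally have "(\<Sum>p=0..n. a p) = 0"
      by (simp add: sum_negf)
    hence "?S = ?S - (\<Sum>p=0..n. a p)" by simp
    also have "\<dots> = (\<Sum>i=0..n. - ?f (Suc i))"
      unfolding sum_subtractf[symmetric] by (intro sum.cong) (auto simp: a_def algebra_simps)
    finally show ?thesis by (simp add: sum_negf)
  qed
  finally have quad: "(\<theta> (\<theta> G) * G - (\<theta> G)\<^sup>2) $ m = (of_nat m)\<^sup>2 * c m - ?S" by simp
  have cube: "(G * G * G) $ n = (\<Sum>p=0..n. \<Sum>q=0..p. c (m - p - 2) * c q * c (p - q))"
    unfolding fps_mult_nth G_def sum_distrib_right
    by (intro sum.cong) (auto simp: n mult_ac)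
  have "g_residual \<epsilon> G $ m =
      (\<theta> (\<theta> G) * G - (\<theta> G)\<^sup>2) $ m - 4 * \<epsilon> * (G * G * G) $ n - c m"
    unfolding g_residual_def Let_def \<theta>_def[symmetric]
    by (simp add: fps_X_power2_mult_nth n G_def mult.assoc)
  thus ?thesis
    unfolding quad cube by (simp add: G_def recurrence_rhs_def n algebra_simps)
qed

lemma g_residual_eq_0_iff:
  assumes "c 0 = 1"
  shows "g_residual \<epsilon> (Abs_fps c) = 0 \<longleftrightarrow> coeff_recurrence \<epsilon> c"
proof -
  \<comment> \<open>Order 0 reads -c_0 + 1 = 0 and order 1 reads c_1 - c_1 = 0, so neither
    constrains \<open>c 1\<close>.\<close>
  have "g_residual \<epsilon> (Abs_fps c) $ 0 = 0" "g_residual \<epsilon> (Abs_fps c) $ 1 = 0"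
    by (simp_all add: g_residual_def Let_def power2_eq_square fps_mult_nth_1 assms)
  moreover have "m = 0 \<or> m = 1 \<or> m \<ge> 2" for m :: nat by auto
  ultimately have "g_residual \<epsilon> (Abs_fps c) = 0 \<longleftrightarrow> (\<forall>m\<ge>2. g_residual \<epsilon> (Abs_fps c) $ m = 0)"
    unfolding fps_eq_iff by (metis fps_zero_nth)
  thus ?thesis
    using g_residual_nth[where c = c and \<epsilon> = \<epsilon>, OF assms] by (simp add: coeff_recurrence_altdef)
qed

lemma y_residual_eq_0_iff:
  assumes "c 0 = 1"
  shows "y_residual \<epsilon> (y_series c) = 0 \<longleftrightarrow> coeff_recurrence \<epsilon> c"
  unfolding y_series_def y_residual_eq_g_residual g_residual_eq_0_iff[of c, OF assms, symmetric]
  by simp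

text \<open>Multiplication by the nonzero factor x y clears all denominators. The general field lets
  one identity serve both formal Laurent series and pointwise complex values.\<close>

lemma cleared_ode_iff:
  fixes e x y y' y'' :: "'a :: field_char_0"
  assumes "x \<noteq> 0" "y \<noteq> 0"
  shows "y'' = y'\<^sup>2 / y - y' / x - (1 / x) * (8 * e * y\<^sup>2 + 1 / 2) - 1 / (4 * y) \<longleftrightarrow>
    x * (y * y'' - y'\<^sup>2) + y * y' + (8 * e) * y ^ 3 + (1 / 2) * y + (1 / 4) * x = 0"
proof -
  have "x * (y * y'' - y'\<^sup>2) + y * y' + (8 * e) * y ^ 3 + (1 / 2) * y + (1 / 4) * x =
     (x * y) * (y'' - (y'\<^sup>2 / y - y' / x - (1 / x) * (8 * e * y\<^sup>2 + 1 / 2) - 1 / (4 * y)))"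
    using assms by (simp add: field_simps power2_eq_square power3_eq_cube)
  thus ?thesis using assms by simp
qed

text \<open>Division takes place in the Laurent field; once denominators are cleared, the equation
  lies in the image of the injective ring homomorphism \<open>fps_to_fls\<close>.\<close>

lemma ode_formal_solution_iff:
  assumes "Y \<noteq> 0"
  shows "ode_formal_solution \<epsilon> (fps_to_fls Y) \<longleftrightarrow> y_residual \<epsilon> Y = 0"
proof -
  have nz: "fls_X \<noteq> (0 :: complex fls)" "fps_to_fls Y \<noteq> 0"
    using assms by simp_all
  have fls_consts: "fls_const (8 * \<epsilon>) = 8 * fls_const \<epsilon>"
    "fls_const (1 / 2) = (1 / 2 :: complex fls)" "fls_const (1 / 4) = (1 / 4 :: complex fls)"
    by (simp_all flip: fls_const_mult_const fls_const_divide_const)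
  have "ode_formal_solution \<epsilon> (fps_to_fls Y) \<longleftrightarrow> fps_to_fls (y_residual \<epsilon> Y) = 0"
    unfolding ode_formal_solution_def cleared_ode_iff[OF nz] y_residual_def
    using assms
    by (simp add: fls_consts fls_times_fps_to_fls fps_to_fls_power fps_to_fls_plus fps_to_fls_minus
        fls_deriv_fps_to_fls del: fps_const_mult)
  thus ?thesis by simp
qed

section \<open>Majorant estimate and positive radius of convergence\<close>

lemma sum_convolution_le_prod_sum:
  fixes a b :: "nat \<Rightarrow> real"
  assumes "\<And>k. a k \<ge> 0" "\<And>k. b k \<ge> 0"
  shows "(\<Sum>k<n. \<Sum>p\<le>k. a p * b (k - p)) \<le> (\<Sum>k<n. a k) * (\<Sum>k<n. b k)"
proof -
  \<comment> \<open>The convolutions run over the triangle i + j < n; for nonnegative terms,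
    enlarging it to a square can only increase the sum.\<close>
  have "(\<Sum>k<n. \<Sum>p\<le>k. a p * b (k - p)) = (\<Sum>(i,j)\<in>{(i,j). i + j < n}. a i * b j)"
    by (rule sum.triangle_reindex[symmetric])
  also have "\<dots> \<le> (\<Sum>(i,j)\<in>{..<n}\<times>{..<n}. a i * b j)"
    by (rule sum_mono2) (auto simp: assms)
  also have "\<dots> = (\<Sum>k<n. a k) * (\<Sum>k<n. b k)"
    by (simp add: sum_product sum.cartesian_product)
  finally show ?thesis .
qed

text \<open>With m = k + 2, division by m^2 - 1 absorbs the weights of the quadratic sum. Only
  unweighted convolutions remain, the form in which partial sums are bounded by products.\<close>

lemma norm_recurrence_coeff_le:
  assumes "coeff_recurrence \<epsilon> c"
  shows "norm (c (k + 2)) \<le> (\<Sum>p\<le>k. norm (c (Suc p)) * norm (c (Suc (k - p))))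
    + 4 * norm \<epsilon> * (\<Sum>p\<le>k. (\<Sum>q\<le>p. norm (c q) * norm (c (p - q))) * norm (c (k - p)))"
    (is "_ \<le> ?A + 4 * norm \<epsilon> * ?B")
proof -
  define M where "M = (real (k + 2))\<^sup>2 - 1"
  have M: "M \<ge> 1" "real (k + 2) * real k \<le> M"
    unfolding M_def by (simp_all add: power2_eq_square algebra_simps)
  have A: "norm (\<Sum>p=0..k. (of_nat p + 2) * (of_nat (k + 2) - 2 * (of_nat p + 1))
      * c (p + 1) * c (k + 2 - p - 1)) \<le> M * ?A" (is "norm ?A' \<le> _")
    unfolding sum_distrib_left atLeast0AtMost
  proof (intro sum_norm_le)
    fix p assume p: "p \<in> {..k}"
    have "norm (of_nat p + 2 :: complex) = real (p + 2)"
      using norm_of_nat[of "p + 2", where 'a = complex]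
      by (simp only: of_nat_add of_nat_numeral)
    also have "\<dots> \<le> real (k + 2)" using p by simp
    finally have 1: "norm (of_nat p + 2 :: complex) \<le> real (k + 2)" .
    have "norm (of_nat (k + 2) - 2 * (of_nat p + 1) :: complex)
        = norm (of_real (real k - 2 * real p) :: complex)"
      by (intro arg_cong[where f = norm]) simp
    \<comment> \<open>Here |k - 2p| <= k because 0 <= p <= k.\<close>
    also have "\<dots> \<le> real k" unfolding norm_of_real using p by simp
    finally have "norm ((of_nat p + 2) * (of_nat (k + 2) - 2 * (of_nat p + 1)) :: complex)
        \<le> real (k + 2) * real k"
      unfolding norm_mult using 1 by (intro mult_mono) auto
    also note M(2)
    finally have "norm ((of_nat p + 2) * (of_nat (k + 2) - 2 * (of_nat p + 1)) :: complex)
        * (norm (c (Suc p)) * norm (c (Suc (k - p))))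
        \<le> M * (norm (c (Suc p)) * norm (c (Suc (k - p))))"
      by (intro mult_right_mono) auto
    moreover have "k + 2 - p - 1 = Suc (k - p)" using p by simp
    ultimately show "norm ((of_nat p + 2) * (of_nat (k + 2) - 2 * (of_nat p + 1))
      * c (p + 1) * c (k + 2 - p - 1)) \<le> M * (norm (c (Suc p)) * norm (c (Suc (k - p))))"
      by (simp add: norm_mult mult.assoc)
  qed
  have B: "norm (\<Sum>p=0..k. \<Sum>q=0..p. c (k + 2 - p - 2) * c q * c (p - q)) \<le> ?B"
    (is "norm ?B' \<le> _")
    unfolding sum_distrib_right atLeast0AtMost
    by (intro sum_norm_le) (simp add: norm_mult mult_ac)
  have "((of_nat (k + 2))\<^sup>2 - 1) * c (k + 2) = ?A' + 4 * \<epsilon> * ?B'"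
    using assms[unfolded coeff_recurrence_def, rule_format, of "k + 2"] by simp
  moreover have "((of_nat (k + 2))\<^sup>2 - 1 :: complex) = of_real M"
    by (simp add: M_def)
  moreover have "M * norm (c (k + 2)) = norm (of_real M * c (k + 2))"
    using M(1) by (simp add: norm_mult)
  ultimately have "M * norm (c (k + 2)) = norm (?A' + 4 * \<epsilon> * ?B')"
    by (simp only:)
  also have "\<dots> \<le> norm ?A' + 4 * norm \<epsilon> * norm ?B'"
    by (rule norm_triangle_le) (simp only: norm_mult norm_numeral order_refl)
  also have "\<dots> \<le> M * ?A + 4 * norm \<epsilon> * ?B"
    using A B by (intro add_mono mult_left_mono) auto
  \<comment> \<open>The cubic term has no weight to absorb; \<open>M\<close> is at least 1 and may
    be inserted there, so that it cancels as a common factor.\<close>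
  also have "\<dots> \<le> M * ?A + M * (4 * norm \<epsilon> * ?B)"
    using M(1) by (intro add_left_mono mult_right_mono[of 1 M, simplified]
      mult_nonneg_nonneg sum_nonneg) auto
  finally have "M * norm (c (k + 2)) \<le> M * (?A + 4 * norm \<epsilon> * ?B)"
    by (simp only: distrib_left)
  thus ?thesis using M(1) by simp
qed

text \<open>The constants make the induction close exactly: 1/8 from the c_1 term, (1/2)^2 = 1/4
  from the quadratic part, and 4 (1/108) (3/2)^3 = 1/8 from the cubic part add up to 1/2.\<close>

lemma sum_norm_recurrence_coeff_le:
  assumes "coeff_recurrence \<epsilon> c" "c 0 = 1"
    and t: "t \<ge> 0" "norm (c 1) * t \<le> 1 / 8" "norm \<epsilon> * t\<^sup>2 \<le> 1 / 108"
  shows "(\<Sum>k<n. norm (c (Suc k)) * t ^ Suc k) \<le> 1 / 2"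
proof (induction n)
  case (Suc n)
  define a where "a = (\<lambda>k. norm (c k) * t ^ k)"
  have a: "a k \<ge> 0" for k using t(1) by (simp add: a_def)
  define U where "U = (\<Sum>k<n. a (Suc k))"
  have U: "0 \<le> U" "U \<le> 1 / 2"
    using Suc by (auto simp: U_def a intro!: sum_nonneg) (simp add: a_def)
  \<comment> \<open>Unlike \<open>U\<close>, this sum starts with the term of c_0 = 1, so its bound
    is 1 + 1/2 = 3/2.\<close>
  define T where "T = (\<Sum>k<n. a k)"
  have "T \<le> (\<Sum>k<Suc n. a k)" unfolding T_def using a by simp
  also have "\<dots> = 1 + U" unfolding sum.lessThan_Suc_shift U_def by (simp add: a_def assms(2))
  finally have T: "0 \<le> T" "T \<le> 3 / 2"
    using U a unfolding T_def by (auto intro!: sum_nonneg)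
  let ?A = "\<lambda>k. \<Sum>p\<le>k. a (Suc p) * a (Suc (k - p))"
  let ?B = "\<lambda>k. \<Sum>p\<le>k. (\<Sum>q\<le>p. a q * a (p - q)) * a (k - p)"
  have step: "a (Suc (Suc k)) \<le> ?A k + 4 * (norm \<epsilon> * t\<^sup>2) * ?B k" for k
  proof -
    define P where "P = (\<Sum>p\<le>k. norm (c (Suc p)) * norm (c (Suc (k - p))))"
    define Q where "Q = (\<Sum>p\<le>k. (\<Sum>q\<le>p. norm (c q) * norm (c (p - q))) * norm (c (k - p)))"
    \<comment> \<open>The indices in the quadratic sum add up to k + 2, those in the cubic sum only
      to k. The spare t^2 is paired with \<epsilon> and makes the cubic part small.\<close>
    have t_power: "t ^ (k + 2) = t\<^sup>2 * t ^ k" by (simp add: power2_eq_square)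
    have P: "?A k = t ^ (k + 2) * P"
      unfolding P_def sum_distrib_left a_def
    proof (intro sum.cong refl)
      fix p assume "p \<in> {..k}"
      hence "t ^ (k + 2) = t ^ Suc p * t ^ Suc (k - p)" by (simp flip: power_add)
      thus "norm (c (Suc p)) * t ^ Suc p * (norm (c (Suc (k - p))) * t ^ Suc (k - p)) =
        t ^ (k + 2) * (norm (c (Suc p)) * norm (c (Suc (k - p))))" by (simp only: mult_ac)
    qed
    have Q: "?B k = t ^ k * Q"
      unfolding Q_def sum_distrib_left sum_distrib_right a_def
    proof (intro sum.cong refl)
      fix p q assume "p \<in> {..k}" "q \<in> {..p}"
      hence "t ^ k = t ^ q * t ^ (p - q) * t ^ (k - p)" by (simp flip: power_add)
      thus "norm (c q) * t ^ q * (norm (c (p - q)) * t ^ (p - q)) * (norm (c (k - p)) * t ^ (k - p))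
        = t ^ k * (norm (c q) * norm (c (p - q)) * norm (c (k - p)))" by (simp only: mult_ac)
    qed
    have "a (Suc (Suc k)) \<le> t ^ (k + 2) * (P + 4 * norm \<epsilon> * Q)"
      using mult_left_mono[OF norm_recurrence_coeff_le[OF assms(1), of k], of "t ^ (k + 2)"] t(1)
      by (simp add: a_def P_def Q_def mult.commute)
    thus ?thesis
      unfolding P Q t_power by (simp add: algebra_simps)
  qed
  \<comment> \<open>The triple convolution is a convolution of a convolution, so the product bound
    is applied twice.\<close>
  have "(\<Sum>k<n. ?B k) \<le> (\<Sum>k<n. \<Sum>q\<le>k. a q * a (k - q)) * T"
    unfolding T_def using a by (intro sum_convolution_le_prod_sum sum_nonneg) auto
  also have "\<dots> \<le> (T * T) * T"
    using T(1) a sum_convolution_le_prod_sum[of a a n] unfolding T_def by (intro mult_right_mono) auto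
  also have "\<dots> \<le> (3 / 2 * (3 / 2)) * (3 / 2)"
    using T by (intro mult_mono) auto
  finally have B: "(\<Sum>k<n. ?B k) \<le> 27 / 8" by simp
  have B0: "0 \<le> (\<Sum>k<n. ?B k)"
    using a by (intro sum_nonneg mult_nonneg_nonneg) auto
  have "(\<Sum>k<n. ?A k) \<le> U * U"
    unfolding U_def using a by (intro sum_convolution_le_prod_sum) auto
  also have "\<dots> \<le> 1 / 2 * (1 / 2)"
    using U by (intro mult_mono) auto
  finally have A: "(\<Sum>k<n. ?A k) \<le> 1 / 4" by simp
  have "(\<Sum>k<n. a (Suc (Suc k))) \<le> (\<Sum>k<n. ?A k) + 4 * (norm \<epsilon> * t\<^sup>2) * (\<Sum>k<n. ?B k)"
    unfolding sum_distrib_left[of _ ?B] sum.distrib[symmetric] by (intro sum_mono step)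
  also have "\<dots> \<le> 1 / 4 + 4 * (1 / 108) * (27 / 8)"
    using A B B0 t(3) by (intro add_mono mult_mono mult_left_mono) auto
  finally have "(\<Sum>k<n. a (Suc (Suc k))) \<le> 3 / 8" by simp
  hence "(\<Sum>k<Suc n. a (Suc k)) \<le> 1 / 2"
    using t(2) unfolding sum.lessThan_Suc_shift by (simp add: a_def)
  thus ?case by (simp only: a_def)
qed simp

lemma fps_conv_radius_recurrence_pos:
  assumes "coeff_recurrence \<epsilon> c" "c 0 = 1"
  shows "fps_conv_radius (Abs_fps c) > 0"
proof -
  define D where "D = 1 + norm (c 1) + norm \<epsilon>"
  \<comment> \<open>Since \<open>D\<close> is at least 1 and dominates both parameters, this t meets
    both smallness conditions; t <= 1 gives t^2 <= t for the second.\<close>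
  define t where "t = 1 / (108 * D)"
  have D: "D \<ge> 1" "norm (c 1) \<le> D" "norm \<epsilon> \<le> D" by (simp_all add: D_def)
  have t: "t > 0" "t \<le> 1" "norm (c 1) * t \<le> 1 / 108" "norm \<epsilon> * t \<le> 1 / 108"
    unfolding t_def using D by (simp_all add: field_simps)
  have "norm \<epsilon> * t\<^sup>2 \<le> norm \<epsilon> * t"
    using t by (intro mult_left_mono) (auto simp: power2_eq_square mult_le_one)
  hence "(\<Sum>k<n. norm (c (Suc k)) * t ^ Suc k) \<le> 1 / 2" for n
    using t by (intro sum_norm_recurrence_coeff_le[OF assms]) auto
  hence "summable (\<lambda>k. norm (c (Suc k)) * t ^ Suc k)"
    using t(1) by (intro summableI_nonneg_bounded[where x = "1 / 2"]) auto
  hence "summable (\<lambda>k. norm (c k) * t ^ k)"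
    by (simp only: summable_Suc_iff[of "\<lambda>k. norm (c k) * t ^ k"])
  hence "summable (\<lambda>k. norm (c k * of_real t ^ k))"
    using t(1) by (simp add: norm_mult norm_power)
  hence "conv_radius c \<ge> norm (of_real t :: complex)"
    by (rule conv_radius_geI[OF summable_norm_cancel])
  hence "ereal t \<le> conv_radius c" using t(1) by simp
  moreover have "0 < ereal t" using t(1) by simp
  ultimately have "0 < conv_radius c" by (rule order.strict_trans2[rotated])
  thus ?thesis by (simp add: fps_conv_radius_def)
qed

section \<open>From the formal series to analytic solutions\<close>

lemma degenerate_PIII_solution_on_iff_ode_solution_on:
  assumes "\<kappa> \<in> {1, -1}"
  shows "degenerate_PIII_solution_on \<epsilon> (\<kappa> * \<i> / 2) (\<kappa> * \<i> / 2) y S \<longleftrightarrow> ode_solution_on \<epsilon> y S"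
proof -
  \<comment> \<open>Only \<kappa>^2 = 1 enters, so both signs give ab = b^2 = -1/4.\<close>
  have ab: "2 * (\<kappa> * \<i> / 2) * (\<kappa> * \<i> / 2) = - 1 / 2" "(\<kappa> * \<i> / 2)\<^sup>2 = - 1 / 4"
    using assms by (auto simp: power2_eq_square)
  have "A + (1 / x) * (- 8 * \<epsilon> * u + - 1 / 2) + (- 1 / 4) / v =
      A - (1 / x) * (8 * \<epsilon> * u + 1 / 2) - 1 / (4 * v)" for A x u v :: complex
    by (simp add: algebra_simps)
  thus ?thesis
    unfolding degenerate_PIII_solution_on_def ode_solution_on_def ab by simp
qed

text \<open>Expansions respect ring operations and derivatives, so the cleared equation evaluated at
  \<open>y\<close> expands to \<open>y_residual\<close>, which is 0; hence it holds near 0. The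
  origin is removed because x and y vanish there.\<close>

lemma analytic_solution_of_recurrence:
  assumes "coeff_recurrence \<epsilon> c" "c 0 = 1"
  obtains y r where "r > 0" "y holomorphic_on ball 0 r" "y has_fps_expansion y_series c"
    "ode_solution_on \<epsilon> y (ball 0 r - {0})"
proof -
  define g where "g = eval_fps (Abs_fps c)"
  define y where "y = (\<lambda>x. - 1 / 2 * x * g x)"
  have g: "g has_fps_expansion Abs_fps c"
    unfolding g_def by (intro eval_fps_has_fps_expansion fps_conv_radius_recurrence_pos[OF assms])
  have y: "y has_fps_expansion y_series c"
    unfolding y_def y_series_def by (intro fps_expansion_intros g)
  have "(\<lambda>x. x * (y x * deriv (deriv y) x - (deriv y x)\<^sup>2) + y x * deriv y x + (8 * \<epsilon>) * y x ^ 3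
      + (1 / 2) * y x + (1 / 4) * x) has_fps_expansion y_residual \<epsilon> (y_series c)"
    unfolding y_residual_def by (intro fps_expansion_intros y)
  hence ode: "\<forall>\<^sub>F x in nhds 0. x * (y x * deriv (deriv y) x - (deriv y x)\<^sup>2) + y x * deriv y x
      + (8 * \<epsilon>) * y x ^ 3 + (1 / 2) * y x + (1 / 4) * x = 0"
    using y_residual_eq_0_iff[of c \<epsilon>] assms by (simp add: has_fps_expansion_0_iff)
  \<comment> \<open>Continuity and g(0) = 1 keep g nonzero near 0, so y = -x g/2 vanishes there only
    at the origin and the denominators can be restored.\<close>
  have "isCont g 0" "g 0 = 1"
    using has_fps_expansion_imp_continuous[OF g] has_fps_expansion_imp_0_eq_fps_nth_0[OF g] assms
    by simp_all
  hence nz: "\<forall>\<^sub>F x in nhds 0. g x \<noteq> 0"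
    by (intro tendsto_imp_eventually_ne[of g 1]) (auto simp: continuous_at tendsto_nhds_iff)
  obtain r1 where r1: "r1 > 0" "\<And>x. dist x 0 < r1 \<Longrightarrow> g x \<noteq> 0"
    "\<And>x. dist x 0 < r1 \<Longrightarrow> x * (y x * deriv (deriv y) x - (deriv y x)\<^sup>2) + y x * deriv y x
      + (8 * \<epsilon>) * y x ^ 3 + (1 / 2) * y x + (1 / 4) * x = 0"
    using eventually_conj[OF nz ode] unfolding eventually_nhds_metric by blast
  obtain r2 where r2: "r2 > 0" "y holomorphic_on ball 0 r2"
    using has_fps_expansion_imp_holomorphic[OF y] openE holomorphic_on_subset by metis
  define r where "r = min r1 r2"
  have hol: "y holomorphic_on ball 0 r"
    using r2(2) by (rule holomorphic_on_subset) (auto simp: r_def)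
  have "ode_solution_on \<epsilon> y (ball 0 r - {0})"
    unfolding ode_solution_on_def
  proof (intro conjI ballI)
    fix x :: complex assume x: "x \<in> ball 0 r - {0}"
    hence x': "x \<noteq> 0" "dist x 0 < r1" by (auto simp: r_def dist_commute)
    show "x \<noteq> 0" by fact
    show "y x \<noteq> 0" using x' r1(2) by (simp add: y_def)
    thus "deriv (deriv y) x = (deriv y x)\<^sup>2 / y x - deriv y x / x
        - (1 / x) * (8 * \<epsilon> * (y x)\<^sup>2 + 1 / 2) - 1 / (4 * y x)"
      using r1(3)[OF x'(2)] x'(1) by (subst cleared_ode_iff) auto
  qed (auto intro: holomorphic_on_subset[OF hol])
  with hol y r1(1) r2(1) show ?thesis
    by (intro that[of r y]) (auto simp: r_def)
qed

theorem proposition2p3: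
  fixes \<epsilon> c1 :: complex
  assumes "\<epsilon> \<noteq> 0"
  shows "(\<exists>!c. c 0 = 1 \<and> c 1 = c1 \<and> coeff_recurrence \<epsilon> c) \<and>
    (\<forall>c. c 0 = 1 \<and> c 1 = c1 \<longrightarrow>
       (ode_formal_solution \<epsilon> (fps_to_fls (y_series c)) \<longleftrightarrow> coeff_recurrence \<epsilon> c)) \<and>
    (\<forall>c. c 0 = 1 \<and> c 1 = c1 \<and> coeff_recurrence \<epsilon> c \<longrightarrow>
       fps_conv_radius (y_series c) > 0 \<and>
       (\<exists>y r. r > 0 \<and> y holomorphic_on ball 0 r \<and> y has_fps_expansion y_series c \<and>
          ode_solution_on \<epsilon> y (ball 0 r - {0}) \<and>
          (\<forall>\<kappa>\<in>{1, -1}. degenerate_PIII_solution_on \<epsilon> (\<kappa> * \<i> / 2) (\<kappa> * \<i> / 2) y (ball 0 r - {0}))))"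
proof (intro conjI allI impI)
  show "\<exists>!c. c 0 = 1 \<and> c 1 = c1 \<and> coeff_recurrence \<epsilon> c"
    using coeff_recurrence_exists[of c1 \<epsilon>] coeff_recurrence_unique[of \<epsilon>] by metis
next
  fix c :: "nat \<Rightarrow> complex" assume c: "c 0 = 1 \<and> c 1 = c1"
  \<comment> \<open>This coefficient is -c_0/2 = -1/2; it makes the series nonzero, as division by
    it demands.\<close>
  hence "y_series c $ 1 \<noteq> 0" by (simp add: y_series_def mult.assoc)
  hence "y_series c \<noteq> 0" by auto
  with c show "ode_formal_solution \<epsilon> (fps_to_fls (y_series c)) \<longleftrightarrow> coeff_recurrence \<epsilon> c"
    by (simp add: ode_formal_solution_iff y_residual_eq_0_iff)
next
  fix c assume c: "c 0 = 1 \<and> c 1 = c1 \<and> coeff_recurrence \<epsilon> c"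
  then obtain y r where y: "r > 0" "y holomorphic_on ball 0 r" "y has_fps_expansion y_series c"
    "ode_solution_on \<epsilon> y (ball 0 r - {0})"
    using analytic_solution_of_recurrence by metis
  \<comment> \<open>A positive radius is part of the meaning of
    \<open>has_fps_expansion\<close>.\<close>
  thus "fps_conv_radius (y_series c) > 0"
    by (simp add: has_fps_expansion_def)
  from y show "\<exists>y r. r > 0 \<and> y holomorphic_on ball 0 r \<and> y has_fps_expansion y_series c \<and>
      ode_solution_on \<epsilon> y (ball 0 r - {0}) \<and>
      (\<forall>\<kappa>\<in>{1, -1}. degenerate_PIII_solution_on \<epsilon> (\<kappa> * \<i> / 2) (\<kappa> * \<i> / 2) y (ball 0 r - {0}))"
    using degenerate_PIII_solution_on_iff_ode_solution_on by blast
qed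

end
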